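(* Let $p\geq 2$ be an integer, and let $(V_k)_{k\geq 0}$ be the sequence of complex rational functions in the variable $z$ defined by the iteration $$V_{k+1}(z)=\frac{(p-1)V_k^p(z)+(p+1)(1-z)}{(p+1)V_k^{p}(z)+(p-1)(1-z)}\,V_k(z),\qquad V_0(z)\equiv 1$$ (which is obtained when Halley's method is applied to solve $x^p=1-z$ starting from $1$). Then for every $k\geq 1$ and every $z\in\overline{D(0,1)}\setminus\{0,1\}$ we have $$\left|1-\frac{1-z}{V_k^p(z)}\right|<|z|^{3^k}.$$ In particular, $V_k$ has no zeros, nor poles, in $\overline{D(0,1)}$.
   Context: $\overline{D(0,1)}=\{z\in\mathbb{C}:|z|\leq 1\}$ is the closed unit disk. $V_k^p(z)$ denotes the $p$-th power $(V_k(z))^p$. The $V_k$ are elements of the field $\mathbb{C}(z)$ of rational functions, and the iteration is an identity in this field; $1-\frac{1-z}{V_k^p(z)}$ is likewise regarded as a rational function of $z$. *)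

theory Defs
  imports
    "HOL-Analysis.Analysis"
    "HOL-Computational_Algebra.Computational_Algebra"
    "HOL-Computational_Algebra.Field_as_Ring"
begin

type_synonym ratfun = "complex poly fract"

definition rf_var :: ratfun
  where "rf_var = to_fract [:0, 1:]"

text \<open>
  \<^const>\<open>quot_of_fract\<close> yields the representation in lowest terms (coprime numerator and
  denominator, monic denominator), so zeros and poles are those remaining after cancellation.
  Every point is a zero of the zero function. At a pole \<open>rf_eval\<close> has a junk value.
\<close>

definition rf_zero :: "ratfun \<Rightarrow> complex \<Rightarrow> bool"
  where "rf_zero r z \<longleftrightarrow> poly (fst (quot_of_fract r)) z = 0"

definition rf_pole :: "ratfun \<Rightarrow> complex \<Rightarrow> bool"
  where "rf_pole r z \<longleftrightarrow> poly (snd (quot_of_fract r)) z = 0"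

definition rf_eval :: "ratfun \<Rightarrow> complex \<Rightarrow> complex"
  where "rf_eval r z = poly (fst (quot_of_fract r)) z / poly (snd (quot_of_fract r)) z"

lemma rf_regular_iff:
  "\<not> rf_pole r z \<longleftrightarrow> (\<exists>a b. r = to_fract a / to_fract b \<and> poly b z \<noteq> 0)"
proof
  assume "\<not> rf_pole r z"
  moreover have "r = to_fract (fst (quot_of_fract r)) / to_fract (snd (quot_of_fract r))"
    by (metis Fract_conv_to_fract prod.collapse quot_to_fract_def quot_to_fract_quot_of_fract
        split_conv)
  ultimately show "\<exists>a b. r = to_fract a / to_fract b \<and> poly b z \<noteq> 0"
    unfolding rf_pole_def by blast
next
  assume "\<exists>a b. r = to_fract a / to_fract b \<and> poly b z \<noteq> 0"
  then obtain a b where r: "r = to_fract a / to_fract b" and b: "poly b z \<noteq> 0" by blast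
  from b have b0: "b \<noteq> 0" by auto
  have q: "quot_of_fract r = normalize_quot (a, b)"
    using quot_of_fract_quot_to_fract[of "(a, b)"]
    by (simp add: r quot_to_fract_def Fract_conv_to_fract)
  obtain d where "b = snd (normalize_quot (a, b)) * d"
    using normalize_quotE[OF b0, of a] by metis
  then have "poly b z = poly (snd (quot_of_fract r)) z * poly d z"
    unfolding q by (metis poly_mult)
  with b show "\<not> rf_pole r z" by (auto simp: rf_pole_def)
qed

lemma rf_eval_quotient:
  assumes "poly b z \<noteq> 0"
  shows "rf_eval (to_fract a / to_fract b) z = poly a z / poly b z"
proof -
  from assms have b0: "b \<noteq> 0" by auto
  have q: "quot_of_fract (to_fract a / to_fract b) = normalize_quot (a, b)"
    using quot_of_fract_quot_to_fract[of "(a, b)"]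
    by (simp add: quot_to_fract_def Fract_conv_to_fract)
  obtain d where "a = fst (normalize_quot (a, b)) * d" "b = snd (normalize_quot (a, b)) * d"
    using normalize_quotE[OF b0, of a] by metis
  then have "poly a z = poly (fst (normalize_quot (a, b))) z * poly d z"
    "poly b z = poly (snd (normalize_quot (a, b))) z * poly d z"
    by (metis poly_mult)+
  with assms show ?thesis by (simp add: rf_eval_def q)
qed

text \<open>
  The division is that of the field of rational functions, where \<open>x / 0 = 0\<close>; were the denominator
  of a step to vanish identically, the next iterate would be the zero function.
\<close>

primrec halley_iter :: "nat \<Rightarrow> nat \<Rightarrow> ratfun" where
  "halley_iter p 0 = 1"
| "halley_iter p (Suc k) =
     ((of_nat p - 1) * halley_iter p k ^ p + (of_nat p + 1) * (1 - rf_var)) /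
     ((of_nat p + 1) * halley_iter p k ^ p + (of_nat p - 1) * (1 - rf_var)) *
     halley_iter p k"

end

theory Submission
  imports Defs
begin

text \<open>
  The residuals \<open>r\<^sub>k = 1 - (1 - z) / V\<^sub>k\<^sup>p\<close> satisfy \<open>r\<^sub>0 = z\<close> and \<open>r\<^sub>k\<^sub>+\<^sub>1 = f(r\<^sub>k)\<close>, where
  \<open>f(t) = 1 - (1 - t) (A / B)\<^sup>p\<close> with \<open>A = 2p - (p - 1) t\<close> and \<open>B = 2p - (p + 1) t\<close>. Here
  \<open>f'(t) = (p\<^sup>2 - 1) t\<^sup>2 (A / B)\<^bsup>p-1\<^esup> / B\<^sup>2\<close>. As \<open>A / B\<close> is a positive combination of \<open>1\<close> and \<open>1 / B\<close>,
  this gives \<open>\<bar>f'(st)\<bar> < \<bar>t\<bar>\<^sup>2 f'(s)\<close> for \<open>0 < s < 1\<close>, \<open>\<bar>t\<bar> \<le> 1\<close> and \<open>t \<noteq> 0, 1\<close>. Integrating over \<open>s\<close>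
  and using \<open>f(1) = 1\<close> yields \<open>\<bar>f(t)\<bar> < \<bar>t\<bar>\<^sup>3\<close>.
\<close>

section \<open>The residual map and its derivative\<close>

definition halley_residual :: "nat \<Rightarrow> 'a \<Rightarrow> 'a::real_normed_field" where
  "halley_residual p t =
     1 - (1 - t) * ((2 * of_nat p - (of_nat p - 1) * t) / (2 * of_nat p - (of_nat p + 1) * t)) ^ p"

text \<open>Polymorphic like \<open>halley_residual\<close>: the real instance serves as the
  majorant of the complex one.\<close>

definition halley_residual_deriv :: "nat \<Rightarrow> 'a \<Rightarrow> 'a::real_normed_field" where
  "halley_residual_deriv p t =
     ((2 * of_nat p - (of_nat p - 1) * t) / (2 * of_nat p - (of_nat p + 1) * t)) ^ (p - 1)
     * ((of_nat p ^ 2 - 1) * t ^ 2) / (2 * of_nat p - (of_nat p + 1) * t) ^ 2"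

lemma halley_residual_has_field_derivative:
  fixes t :: "'a::real_normed_field"
  assumes "p > 0" and B: "2 * of_nat p - (of_nat p + 1) * t \<noteq> 0"
  shows "(halley_residual p has_field_derivative halley_residual_deriv p t) (at t within S)"
proof -
  obtain m where p: "p = Suc m" using \<open>p > 0\<close> gr0_implies_Suc by blast
  define P :: 'a where "P = of_nat p"
  define A where "A = 2 * P - (P - 1) * t"
  define B where "B = 2 * P - (P + 1) * t"
  have B0: "B \<noteq> 0" using B by (simp add: B_def P_def)
  have q: "((\<lambda>t. (2 * P - (P - 1) * t) / (2 * P - (P + 1) * t)) has_field_derivative 4 * P / B ^ 2)
      (at t within S)"
    using B0 unfolding B_def
    by (auto intro!: derivative_eq_intros simp: power2_eq_square) (simp add: algebra_simps)
  \<comment> \<open>The constant and linear terms cancel. The remaining double zero at 0 is the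
    source of cubic convergence.\<close>
  have eq: "A * B - 4 * P ^ 2 * (1 - t) = (P ^ 2 - 1) * t ^ 2"
    unfolding A_def B_def by algebra
  have "((\<lambda>t. 1 - (1 - t) * ((2 * P - (P - 1) * t) / (2 * P - (P + 1) * t)) ^ p)
      has_field_derivative (A / B) ^ p - (1 - t) * (P * (A / B) ^ m * (4 * P / B ^ 2)))
      (at t within S)"
    by (rule derivative_eq_intros refl q | simp add: p)+ (simp add: A_def B_def P_def p)
  also have "(A / B) ^ p - (1 - t) * (P * (A / B) ^ m * (4 * P / B ^ 2))
      = (A / B) ^ m * (A * B - 4 * P ^ 2 * (1 - t)) / B ^ 2"
    using B0 by (simp add: p divide_simps power2_eq_square) (simp add: algebra_simps)
  also have "\<dots> = halley_residual_deriv p t"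
    unfolding eq unfolding halley_residual_deriv_def A_def B_def P_def p diff_Suc_1 ..
  finally show ?thesis
    unfolding halley_residual_def[abs_def] P_def .
qed

lemma halley_residual_0 [simp]: "p > 0 \<Longrightarrow> halley_residual p 0 = 0"
  and halley_residual_1 [simp]: "halley_residual p 1 = 1"
  by (simp_all add: halley_residual_def)

section \<open>Estimates on the closed unit disk\<close>

text \<open>The modulus dominates the real part, and 1 is the only point of the closed disk with
  real part 1, so \<open>Re t < 1\<close>. The strictness of the later bounds originates
  here.\<close>

lemma cmod_halley_denom_gt:
  fixes t :: complex
  assumes p: "p \<ge> 2" and t: "cmod t \<le> 1" "t \<noteq> 1" and s: "0 < s" "s < 1"
  shows "2 * real p - (real p + 1) * s < cmod (2 * of_nat p - (of_nat p + 1) * (of_real s * t))"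
proof -
  have "Re t < 1"
  proof (rule ccontr)
    assume "\<not> Re t < 1"
    then have "Re t = 1" using t complex_Re_le_cmod[of t] by linarith
    moreover from this have "Im t = 0" using t cmod_power2[of t]
      by (smt (verit) norm_ge_zero power2_less_eq_zero_iff power_le_one one_power2)
    ultimately show False using t by (simp add: complex_eq_iff)
  qed
  then have "(real p + 1) * (s * Re t) < (real p + 1) * s" using s by simp
  then have "2 * real p - (real p + 1) * s < Re (2 * of_nat p - (of_nat p + 1) * (of_real s * t))"
    by simp
  then show ?thesis using complex_Re_le_cmod order_less_le_trans by blast
qed

lemma halley_denom_pos:
  assumes "p \<ge> 2" "s \<le> 1"
  shows "2 * real p - (real p + 1) * s > 0"
proof -
  have "(real p + 1) * s \<le> (real p + 1) * 1" using assms by (intro mult_left_mono) auto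
  also have "\<dots> < 2 * real p" using assms by simp
  finally show ?thesis by simp
qed

text \<open>On the disk the linear term has modulus at most \<open>p + 1\<close>, respectively
  \<open>p - 1\<close>, and both are less than \<open>2 * p\<close>.\<close>

lemma halley_affine_nonzero:
  fixes t :: complex
  assumes "p \<ge> 2" "cmod t \<le> 1"
  shows "2 * of_nat p - (of_nat p + 1) * t \<noteq> 0" "2 * of_nat p - (of_nat p - 1) * t \<noteq> 0"
proof -
  have P: "real p \<ge> 2" using assms by simp
  have np: "cmod (of_nat p + 1) = real p + 1" "cmod (of_nat p - 1) = real p - 1"
    using norm_of_real[where ?'a = complex, of "real p + 1"]
      norm_of_real[where ?'a = complex, of "real p - 1"] P by simp_all
  have "cmod ((of_nat p + 1) * t) \<le> real p + 1"
    using mult_left_mono[OF assms(2), of "real p + 1"] by (simp add: norm_mult np)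
  then have "cmod ((of_nat p + 1) * t) < cmod (2 * of_nat p)" using P by (simp add: norm_mult)
  then show "2 * of_nat p - (of_nat p + 1) * t \<noteq> 0" by (metis eq_iff_diff_eq_0 less_irrefl)
  have "cmod ((of_nat p - 1) * t) \<le> real p - 1"
    using mult_left_mono[OF assms(2), of "real p - 1"] P by (simp add: norm_mult np)
  then have "cmod ((of_nat p - 1) * t) < cmod (2 * of_nat p)" using P by (simp add: norm_mult)
  then show "2 * of_nat p - (of_nat p - 1) * t \<noteq> 0" by (metis eq_iff_diff_eq_0 less_irrefl)
qed

lemma cmod_halley_residual_deriv_less:
  fixes t :: complex
  assumes p: "p \<ge> 2" and t: "cmod t \<le> 1" "t \<noteq> 0" "t \<noteq> 1" and s: "0 < s" "s < 1"
  shows "cmod (halley_residual_deriv p (of_real s * t)) < cmod t ^ 2 * halley_residual_deriv p s"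
proof -
  define P where "P = real p"
  define A where "A = 2 * of_nat p - (of_nat p - 1) * (of_real s * t)"
  define B where "B = 2 * of_nat p - (of_nat p + 1) * (of_real s * t)"
  define a where "a = 2 * P - (P - 1) * s"
  define b where "b = 2 * P - (P + 1) * s"
  have P: "P \<ge> 2" using p by (simp add: P_def)
  then have P2: "P ^ 2 - 1 > 0" using one_less_power[of P 2] by simp
  have b: "b > 0" using halley_denom_pos[of p s] p s by (simp add: b_def P_def)
  have bB: "b < cmod B" using cmod_halley_denom_gt[of p t s] p t s by (simp add: B_def b_def P_def)
  then have B_pos: "cmod B > 0" using b by linarith
  then have B0: "B \<noteq> 0" by auto
  have "b \<le> a" using s P by (simp add: a_def b_def algebra_simps)
  then have a: "a > 0" using b by linarith
  \<comment> \<open>Partial fractions with positive coefficients: the triangle inequality for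
    \<open>A / B\<close> then gives a bound that depends on \<open>cmod B\<close> alone and becomes
    \<open>a / b\<close> when \<open>cmod B\<close> is replaced by \<open>b\<close>.\<close>
  have ab: "a / b = (P - 1) / (P + 1) + 4 * P / (P + 1) / b"
    using b P by (simp add: divide_simps) (simp add: a_def b_def algebra_simps)
  have P1: "of_real P + 1 \<noteq> (0::complex)"
    using P by (metis of_real_1 of_real_add of_real_eq_0_iff add_pos_pos less_irrefl
        zero_less_one order_less_le_trans zero_less_numeral)
  have "A / B = of_real ((P - 1) / (P + 1)) + of_real (4 * P / (P + 1)) / B"
    using B0 P1 by (simp add: divide_simps) (simp add: A_def B_def P_def algebra_simps)
  then have "cmod (A / B) \<le> cmod (of_real ((P - 1) / (P + 1))) + cmod (of_real (4 * P / (P + 1)) / B)"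
    by (metis norm_triangle_ineq)
  also have "\<dots> = (P - 1) / (P + 1) + 4 * P / (P + 1) / cmod B"
    using P by (simp only: norm_divide norm_of_real) simp
  also have "\<dots> \<le> a / b"
    unfolding ab using bB b P B_pos by (intro add_left_mono divide_left_mono mult_pos_pos) auto
  finally have AB: "cmod (A / B) \<le> a / b" .
  have c: "cmod ((of_nat p ^ 2 - 1) * (of_real s * t) ^ 2) = (P ^ 2 - 1) * (s * cmod t) ^ 2"
  proof -
    have "cmod (of_nat p ^ 2 - 1) = P ^ 2 - 1"
      using norm_of_real[where ?'a = complex, of "P ^ 2 - 1"] P2 by (simp add: P_def)
    then show ?thesis using s by (simp add: norm_mult norm_power)
  qed
  have pos: "(P ^ 2 - 1) * (s * cmod t) ^ 2 > 0" using P2 s t by simp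
  have "cmod (halley_residual_deriv p (of_real s * t))
      = cmod (A / B) ^ (p - 1) * ((P ^ 2 - 1) * (s * cmod t) ^ 2) / cmod B ^ 2"
    unfolding halley_residual_deriv_def A_def[symmetric] B_def[symmetric]
    by (simp only: norm_mult[of "_ ^ (p - 1)"] norm_divide[of _ "_ ^ 2"] norm_power c)
  also have "\<dots> \<le> (a / b) ^ (p - 1) * ((P ^ 2 - 1) * (s * cmod t) ^ 2) / cmod B ^ 2"
    using AB pos by (intro divide_right_mono mult_right_mono power_mono) auto
  \<comment> \<open>Strictness comes from the squared denominator; it needs a nonzero numerator,
    hence \<open>t \<noteq> 0\<close> and \<open>s > 0\<close>.\<close>
  also have "\<dots> < (a / b) ^ (p - 1) * ((P ^ 2 - 1) * (s * cmod t) ^ 2) / b ^ 2"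
    using pos P2 a b bB B_pos by (intro divide_strict_left_mono mult_pos_pos power_strict_mono) auto
  also have "\<dots> = cmod t ^ 2 * halley_residual_deriv p s"
    by (simp add: halley_residual_deriv_def a_def b_def P_def power_mult_distrib)
  finally show ?thesis .
qed

section \<open>Cubic contraction and its iteration\<close>

lemma cmod_halley_residual_less:
  fixes t :: complex
  assumes p: "p \<ge> 2" and t: "cmod t \<le> 1" "t \<noteq> 0" "t \<noteq> 1"
  shows "cmod (halley_residual p t) < cmod t ^ 3"
proof -
  \<comment> \<open>The rotation \<open>c\<close> turns the norm into a real part, so that the real mean value theorem applies.\<close>
  obtain c where c: "cmod c = 1" "c * halley_residual p t = of_real (cmod (halley_residual p t))"
  proof (cases "halley_residual p t = 0")
    case True
    then show ?thesis using that[of 1] by simp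
  next
    case False
    then show ?thesis
      using that[of "of_real (cmod (halley_residual p t)) / halley_residual p t"]
      by (simp add: norm_divide)
  qed
  \<comment> \<open>Since \<open>halley_residual p\<close> fixes 0 and 1, \<open>D 0 = 0\<close> and
    \<open>D 1\<close> is \<open>cmod t ^ 3 - cmod (halley_residual p t)\<close>. The claim is thus
    \<open>D 0 < D 1\<close>.\<close>
  define D where
    "D s = cmod t ^ 3 * halley_residual p s - Re (c * halley_residual p (of_real s * t))" for s
  define D' where "D' s = cmod t ^ 3 * halley_residual_deriv p s
    - Re (c * (halley_residual_deriv p (of_real s * t) * t))" for s
  have p0: "p > 0" using p by simp
  have deriv: "(D has_real_derivative D' s) (at s)" if s: "0 \<le> s" "s \<le> 1" for s
  proof -
    have "cmod (of_real s * t) \<le> 1" using s t by (simp add: norm_mult mult_le_one)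
    then have nz: "2 * of_nat p - (of_nat p + 1) * (of_real s * t) \<noteq> 0"
      using halley_affine_nonzero p by blast
    have "((\<lambda>x. x * t) has_field_derivative t) (at (of_real s))"
      by (auto intro!: derivative_eq_intros)
    from DERIV_chain2[OF halley_residual_has_field_derivative[OF p0 nz] this]
    have "((\<lambda>x. c * halley_residual p (x * t)) has_field_derivative
        c * (halley_residual_deriv p (of_real s * t) * t)) (at (of_real s))"
      by (rule DERIV_cmult)
    from has_vector_derivative_real_field[OF this]
    have "((\<lambda>x. c * halley_residual p (of_real x * t)) has_vector_derivative
        c * (halley_residual_deriv p (of_real s * t) * t)) (at s)"
      by simp
    then have "((\<lambda>x. Re (c * halley_residual p (of_real x * t))) has_real_derivative
        Re (c * (halley_residual_deriv p (of_real s * t) * t))) (at s)"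
      unfolding has_real_derivative_iff_has_vector_derivative
      by (rule bounded_linear.has_vector_derivative[OF bounded_linear_Re])
    moreover have "((\<lambda>x. cmod t ^ 3 * halley_residual p x) has_real_derivative
        cmod t ^ 3 * halley_residual_deriv p s) (at s)"
      using halley_denom_pos[OF p s(2)]
      by (intro DERIV_cmult halley_residual_has_field_derivative p0) simp
    ultimately show ?thesis
      unfolding D_def[abs_def] D'_def by (intro DERIV_diff)
  qed
  \<comment> \<open>At \<open>s = 0\<close> the derivative vanishes, but the mean value theorem
    supplies an interior point. The chain rule factor \<open>t\<close> raises the exponent from 2 to
    3.\<close>
  have pos: "D' s > 0" if s: "0 < s" "s < 1" for s
  proof -
    have "Re (c * (halley_residual_deriv p (of_real s * t) * t))
        \<le> cmod (halley_residual_deriv p (of_real s * t)) * cmod t"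
      by (rule order_trans[OF complex_Re_le_cmod]) (simp add: norm_mult c)
    also have "\<dots> < cmod t ^ 2 * halley_residual_deriv p s * cmod t"
      using cmod_halley_residual_deriv_less[OF p t s] t by (intro mult_strict_right_mono) auto
    finally show ?thesis by (simp add: D'_def power2_eq_square power3_eq_cube mult_ac)
  qed
  obtain \<xi> where "0 < \<xi>" "\<xi> < 1" "D 1 - D 0 = (1 - 0) * D' \<xi>"
    using MVT2[of 0 1 D D'] deriv by auto
  then have "D 0 < D 1" using pos[of \<xi>] by simp
  then show ?thesis using p0 c by (simp add: D_def)
qed

text \<open>Equality holds at the fixed points 0 and 1. Iterated residuals are not known to avoid 0,
  so the inductions rest on this weak form.\<close>

lemma cmod_halley_residual_le:
  fixes t :: complex
  assumes "p \<ge> 2" "cmod t \<le> 1"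
  shows "cmod (halley_residual p t) \<le> cmod t ^ 3"
  using cmod_halley_residual_less[OF assms] assms by (cases "t = 0 \<or> t = 1") auto

lemma cmod_halley_residual_iter_le:
  fixes z :: complex
  assumes "p \<ge> 2" "cmod z \<le> 1"
  shows "cmod ((halley_residual p ^^ k) z) \<le> 1"
proof (induction k)
  case (Suc k)
  then show ?case
    using cmod_halley_residual_le[OF assms(1) Suc]
      power_le_one[of "cmod ((halley_residual p ^^ k) z)" 3]
    by simp
qed (use assms in simp)

text \<open>The first step is strict; each later one cubes the bound, which preserves strictness and
  triples the exponent.\<close>

lemma cmod_halley_residual_iter_less:
  fixes z :: complex
  assumes "p \<ge> 2" "cmod z \<le> 1" "z \<noteq> 0" "z \<noteq> 1" "k \<ge> 1"
  shows "cmod ((halley_residual p ^^ k) z) < cmod z ^ (3 ^ k)"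
  using \<open>k \<ge> 1\<close>
proof (induction k rule: nat_induct_at_least)
  case base
  then show ?case using cmod_halley_residual_less assms by simp
next
  case (Suc k)
  have "cmod ((halley_residual p ^^ Suc k) z) \<le> cmod ((halley_residual p ^^ k) z) ^ 3"
    using cmod_halley_residual_le[OF assms(1) cmod_halley_residual_iter_le[OF assms(1,2)]] by simp
  also have "\<dots> < (cmod z ^ (3 ^ k)) ^ 3"
    using Suc.IH by (intro power_strict_mono) auto
  finally show ?case by (simp add: power_mult[symmetric] mult.commute)
qed

section \<open>Evaluation of rational functions\<close>

text \<open>Regularity and value in one predicate. Any representation with nonvanishing denominator
  is allowed, not only lowest terms, so the field operations preserve it without any
  cancellation.\<close>

definition rf_has_value :: "ratfun \<Rightarrow> complex \<Rightarrow> complex \<Rightarrow> bool" where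
  "rf_has_value r z v \<longleftrightarrow>
     (\<exists>a b. r = to_fract a / to_fract b \<and> poly b z \<noteq> 0 \<and> v = poly a z / poly b z)"

lemma rf_has_valueI:
  "r = to_fract a / to_fract b \<Longrightarrow> poly b z \<noteq> 0 \<Longrightarrow> v = poly a z / poly b z \<Longrightarrow> rf_has_value r z v"
  unfolding rf_has_value_def by blast

lemma rf_has_valueD:
  assumes "rf_has_value r z v"
  shows "\<not> rf_pole r z" "rf_eval r z = v" "v \<noteq> 0 \<Longrightarrow> \<not> rf_zero r z"
proof -
  show "\<not> rf_pole r z" using assms unfolding rf_regular_iff rf_has_value_def by blast
  show eval: "rf_eval r z = v"
    using assms rf_eval_quotient unfolding rf_has_value_def by blast
  show "v \<noteq> 0 \<Longrightarrow> \<not> rf_zero r z"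
    using eval by (auto simp: rf_zero_def rf_eval_def)
qed

lemma rf_has_value_var: "rf_has_value rf_var z z"
  by (rule rf_has_valueI[where a = "[:0, 1:]" and b = 1]) (simp_all add: rf_var_def)

lemma rf_has_value_1: "rf_has_value 1 z 1"
  by (rule rf_has_valueI[where a = 1 and b = 1]) simp_all

lemma rf_has_value_add:
  assumes "rf_has_value r z v" "rf_has_value s z w"
  shows "rf_has_value (r + s) z (v + w)"
proof -
  from assms obtain a b c d where
    r: "r = to_fract a / to_fract b" "poly b z \<noteq> 0" "v = poly a z / poly b z" and
    s: "s = to_fract c / to_fract d" "poly d z \<noteq> 0" "w = poly c z / poly d z"
    unfolding rf_has_value_def by blast
  have "b \<noteq> 0" "d \<noteq> 0" using r s by auto
  then show ?thesis
    using r s by (intro rf_has_valueI[where a = "a * d + c * b" and b = "b * d"])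
      (simp_all add: add_frac_eq)
qed

lemma rf_has_value_minus:
  assumes "rf_has_value r z v"
  shows "rf_has_value (- r) z (- v)"
proof -
  from assms obtain a b where
    r: "r = to_fract a / to_fract b" "poly b z \<noteq> 0" "v = poly a z / poly b z"
    unfolding rf_has_value_def by blast
  then show ?thesis
    by (intro rf_has_valueI[where a = "- a" and b = b]) simp_all
qed

lemma rf_has_value_diff:
  "rf_has_value r z v \<Longrightarrow> rf_has_value s z w \<Longrightarrow> rf_has_value (r - s) z (v - w)"
  using rf_has_value_add[OF _ rf_has_value_minus] by fastforce

lemma rf_has_value_mult:
  assumes "rf_has_value r z v" "rf_has_value s z w"
  shows "rf_has_value (r * s) z (v * w)"
proof -
  from assms obtain a b c d where
    r: "r = to_fract a / to_fract b" "poly b z \<noteq> 0" "v = poly a z / poly b z" and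
    s: "s = to_fract c / to_fract d" "poly d z \<noteq> 0" "w = poly c z / poly d z"
    unfolding rf_has_value_def by blast
  then show ?thesis
    by (intro rf_has_valueI[where a = "a * c" and b = "b * d"]) simp_all
qed

lemma rf_has_value_divide:
  assumes "rf_has_value r z v" "rf_has_value s z w" "w \<noteq> 0"
  shows "rf_has_value (r / s) z (v / w)"
proof -
  from assms obtain a b c d where
    r: "r = to_fract a / to_fract b" "poly b z \<noteq> 0" "v = poly a z / poly b z" and
    s: "s = to_fract c / to_fract d" "poly d z \<noteq> 0" "w = poly c z / poly d z"
    unfolding rf_has_value_def by blast
  then show ?thesis
    using \<open>w \<noteq> 0\<close> by (intro rf_has_valueI[where a = "a * d" and b = "b * c"]) simp_all
qed

lemma rf_has_value_power: "rf_has_value r z v \<Longrightarrow> rf_has_value (r ^ n) z (v ^ n)"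
  by (induction n) (auto intro: rf_has_value_1 rf_has_value_mult)

lemma rf_has_value_of_nat: "rf_has_value (of_nat n) z (of_nat n)"
proof (induction n)
  case 0
  show ?case using rf_has_value_diff[OF rf_has_value_1 rf_has_value_1] by simp
next
  case (Suc n)
  then show ?case using rf_has_value_add[OF rf_has_value_1 Suc] by simp
qed

lemmas rf_has_value_intros = rf_has_value_var rf_has_value_1 rf_has_value_add rf_has_value_diff
  rf_has_value_mult rf_has_value_divide rf_has_value_power rf_has_value_of_nat

section \<open>Halley iterates and their residuals\<close>

text \<open>The three claims support each other in the induction: the residual stays in the disk,
  which keeps the Halley factor finite and nonzero, and this yields the next value and
  residual.\<close>

lemma halley_iter_has_value:
  assumes p: "p \<ge> 2" and z: "cmod z \<le> 1"
  shows "\<exists>v. rf_has_value (halley_iter p k) z v \<and> v \<noteq> 0 \<and>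
    1 - (1 - z) / v ^ p = (halley_residual p ^^ k) z"
proof (induction k)
  case 0
  show ?case by (intro exI[of _ 1]) (simp add: rf_has_value_1)
next
  case (Suc k)
  then obtain v where v: "rf_has_value (halley_iter p k) z v" "v \<noteq> 0"
    and r: "1 - (1 - z) / v ^ p = (halley_residual p ^^ k) z" by blast
  define P :: complex where "P = of_nat p"
  define t where "t = (halley_residual p ^^ k) z"
  define A where "A = 2 * P - (P - 1) * t"
  define B where "B = 2 * P - (P + 1) * t"
  have "cmod t \<le> 1" unfolding t_def by (rule cmod_halley_residual_iter_le[OF p z])
  then have AB: "A \<noteq> 0" "B \<noteq> 0"
    using halley_affine_nonzero[OF p, of t] by (simp_all add: A_def B_def P_def)
  \<comment> \<open>Eliminating \<open>z\<close> exposes \<open>v ^ p\<close> as a common factor of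
    both sides of the Halley fraction, which reduces to \<open>B / A\<close>. Since
    \<open>B / A\<close> multiplies \<open>v\<close>, the residual acquires the factor
    \<open>(A / B) ^ p\<close>.\<close>
  have zv: "1 - z = v ^ p * (1 - t)"
    using v(2) r by (simp add: t_def[symmetric] field_simps)
  have den: "(P + 1) * v ^ p + (P - 1) * (1 - z) = v ^ p * A"
    unfolding zv A_def by algebra
  have num: "(P - 1) * v ^ p + (P + 1) * (1 - z) = v ^ p * B"
    unfolding zv B_def by algebra
  have "rf_has_value (halley_iter p (Suc k)) z
      (((P - 1) * v ^ p + (P + 1) * (1 - z)) / ((P + 1) * v ^ p + (P - 1) * (1 - z)) * v)"
    unfolding halley_iter.simps
    by (intro rf_has_value_intros v(1) rf_has_value_of_nat[of p, folded P_def])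
      (use den v(2) AB in simp)
  then have "rf_has_value (halley_iter p (Suc k)) z (B / A * v)"
    using v(2) by (simp add: num den)
  moreover have "1 - (1 - z) / (B / A * v) ^ p = halley_residual p t"
    using v(2) AB unfolding zv halley_residual_def P_def[symmetric] A_def[symmetric] B_def[symmetric]
    by (simp add: power_mult_distrib power_divide)
  ultimately show ?case
    using v(2) AB by (intro exI[of _ "B / A * v"]) (simp add: t_def)
qed

theorem theorem2p3:
  fixes p :: nat
  assumes "p \<ge> 2"
  shows "(\<forall>k\<ge>1. \<forall>z\<in>cball 0 1 - {0, 1}.
            \<not> rf_pole (1 - (1 - rf_var) / halley_iter p k ^ p) z \<and>
            cmod (rf_eval (1 - (1 - rf_var) / halley_iter p k ^ p) z) < cmod z ^ (3 ^ k)) \<and>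
         (\<forall>k. \<forall>z\<in>cball 0 1. \<not> rf_zero (halley_iter p k) z \<and> \<not> rf_pole (halley_iter p k) z)"
proof (intro conjI allI impI ballI)
  fix k :: nat and z :: complex
  assume k: "k \<ge> 1" and z: "z \<in> cball 0 1 - {0, 1}"
  then have cz: "cmod z \<le> 1" "z \<noteq> 0" "z \<noteq> 1" by auto
  obtain v where v: "rf_has_value (halley_iter p k) z v" "v \<noteq> 0"
    and r: "1 - (1 - z) / v ^ p = (halley_residual p ^^ k) z"
    using halley_iter_has_value[OF assms cz(1)] by blast
  have val: "rf_has_value (1 - (1 - rf_var) / halley_iter p k ^ p) z ((halley_residual p ^^ k) z)"
    unfolding r[symmetric] by (intro rf_has_value_intros v(1)) (use v(2) in simp)
  show "\<not> rf_pole (1 - (1 - rf_var) / halley_iter p k ^ p) z"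
    using rf_has_valueD(1)[OF val] .
  show "cmod (rf_eval (1 - (1 - rf_var) / halley_iter p k ^ p) z) < cmod z ^ (3 ^ k)"
    unfolding rf_has_valueD(2)[OF val] by (rule cmod_halley_residual_iter_less[OF assms cz k])
next
  fix k :: nat and z :: complex
  assume "z \<in> cball 0 1"
  \<comment> \<open>The value lemma includes \<open>z = 0\<close> and \<open>z = 1\<close>, so no
    point of the disk is excepted here.\<close>
  then obtain v where "rf_has_value (halley_iter p k) z v" "v \<noteq> 0"
    using halley_iter_has_value[OF assms, of z k] by auto
  then show "\<not> rf_zero (halley_iter p k) z" "\<not> rf_pole (halley_iter p k) z"
    using rf_has_valueD by blast+
qed

end
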